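(* Let $m\ge2$ and let $\mathcal K=\partial\Delta^{m-1}$, the boundary of an $(m-1)$-simplex (on the vertex set $[m]$). Then $$\mathit{HH}^{-k,2\ell}(\mathcal Z_{\mathcal K})=\begin{cases}\mathbb Z&\text{for }(-k,2\ell)=(0,0),\ (-1,2m);\\ 0&\text{otherwise.}\end{cases}$$
   Context: $\partial\Delta^{m-1}$ consists of all proper subsets of $[m]=\{1,\dots,m\}$. For a simplicial complex $\mathcal K$ on $[m]$ and $I\subset[m]$, the full subcomplex is $\mathcal K_I=\{J\in\mathcal K: J\subset I\}$. All (co)homology has $\mathbb Z$ coefficients; $\widetilde H^*$ is reduced simplicial cohomology, with $\widetilde H^{-1}(\mathcal K_\varnothing)=\mathbb Z$. Moment-angle complex: $\mathcal Z_{\mathcal K}=\bigcup_{I\in\mathcal K}\{z\in(D^2)^m: |z_j|=1\text{ if }j\notin I\}$. Its cohomology has the bigraded Hochster decomposition $H^{-k,2\ell}(\mathcal Z_{\mathcal K})=\bigoplus_{I\subset[m],|I|=\ell}\widetilde H^{\ell-k-1}(\mathcal K_I)$, of total degree $-k+2\ell$. Double cohomology: for $i\in I$ let $\psi_{p;i,I}:\widetilde H^p(\mathcal K_I)\to\widetilde H^p(\mathcal K_{I\setminus\{i\}})$ be induced by inclusion, let $\varepsilon(i,I)=(-1)^{\#\{r\in I: r<i\}}$, and define $d'$ on $\widetilde H^p(\mathcal K_I)$ by $d'=(-1)^{p+1}\sum_{i\in I}\varepsilon(i,I)\psi_{p;i,I}$. Then $d':H^{-k,2\ell}(\mathcal Z_{\mathcal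 K})\to H^{-k+1,2\ell-2}(\mathcal Z_{\mathcal K})$, $(d')^2=0$, and $\mathit{HH}^{-k,2\ell}(\mathcal Z_{\mathcal K})$ denotes the cohomology of $(H^*(\mathcal Z_{\mathcal K}),d')$ at bidegree $(-k,2\ell)$. *)

theory Defs
  imports "HOL-Algebra.FiniteProduct" "HOL-Algebra.Product_Groups"
begin

section \<open>Reduced simplicial cohomology of complexes on a set of natural numbers\<close>

text \<open>A simplicial complex on \<open>[m] = {1..m}\<close>; elements of \<open>[m]\<close> need not be vertices.\<close>

definition simplicial_complex_on :: "nat \<Rightarrow> nat set set \<Rightarrow> bool" where
  "simplicial_complex_on m K \<longleftrightarrow>
     K \<subseteq> Pow {1..m} \<and> {} \<in> K \<and> (\<forall>J\<in>K. \<forall>I. I \<subseteq> J \<longrightarrow> I \<in> K)"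

definition boundary_simplex :: "nat \<Rightarrow> nat set set" where
  "boundary_simplex m = {J. J \<subset> {1..m}}"

definition full_subcomplex :: "nat set set \<Rightarrow> nat set \<Rightarrow> nat set set" where
  "full_subcomplex K I = {J \<in> K. J \<subseteq> I}"

text \<open>Dimensions are integers; the empty simplex is the only one of dimension \<open>-1\<close>, so that the
  cochain complex below is the augmented one.\<close>

definition simplices :: "nat set set \<Rightarrow> int \<Rightarrow> nat set set" where
  "simplices K p = {J \<in> K. int (card J) = p + 1}"

definition cochain_group :: "nat set set \<Rightarrow> int \<Rightarrow> (nat set \<Rightarrow> int) monoid" where
  "cochain_group K p = product_group (simplices K p) (\<lambda>_. integer_group)"

definition incidence :: "nat \<Rightarrow> nat set \<Rightarrow> int" where
  "incidence i I = (-1) ^ card {r \<in> I. r < i}"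

definition coboundary :: "nat set set \<Rightarrow> int \<Rightarrow> (nat set \<Rightarrow> int) \<Rightarrow> (nat set \<Rightarrow> int)" where
  "coboundary K p f = (\<lambda>J\<in>simplices K (p + 1). \<Sum>j\<in>J. incidence j J * f (J - {j}))"

text \<open>The cohomology at \<open>B\<close> of \<open>A \<rightarrow> B \<rightarrow> C\<close>, with maps \<open>f\<close> and \<open>g\<close>.\<close>

definition cohomology_at ::
  "('a, 'r) monoid_scheme \<Rightarrow> ('a \<Rightarrow> 'b) \<Rightarrow> ('b, 's) monoid_scheme \<Rightarrow> ('b \<Rightarrow> 'c) \<Rightarrow>
   ('c, 't) monoid_scheme \<Rightarrow> 'b set monoid" where
  "cohomology_at A f B g C = (B\<lparr>carrier := kernel B C g\<rparr>) Mod (f ` carrier A)"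

definition reduced_cohomology :: "nat set set \<Rightarrow> int \<Rightarrow> (nat set \<Rightarrow> int) set monoid" where
  "reduced_cohomology K p =
     cohomology_at (cochain_group K (p - 1)) (coboundary K (p - 1))
       (cochain_group K p) (coboundary K p) (cochain_group K (p + 1))"

definition cohomology_class ::
  "nat set set \<Rightarrow> int \<Rightarrow> (nat set \<Rightarrow> int) \<Rightarrow> (nat set \<Rightarrow> int) set" where
  "cohomology_class K p f =
     (coboundary K (p - 1) ` carrier (cochain_group K (p - 1))) #>\<^bsub>cochain_group K p\<^esub> f"

text \<open>The map \<open>H\<^sup>p(K) \<rightarrow> H\<^sup>p(L)\<close> induced by the inclusion of a subcomplex \<open>L\<close> of \<open>K\<close>: it sends the
  class \<open>c\<close> of a cocycle \<open>f\<close> to the class of the restriction of \<open>f\<close>. The image under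
  \<^const>\<open>the_elem\<close> is a singleton (see \<open>cohomology_restrict_class\<close> below).\<close>

definition cohomology_restrict ::
  "nat set set \<Rightarrow> nat set set \<Rightarrow> int \<Rightarrow> (nat set \<Rightarrow> int) set \<Rightarrow> (nat set \<Rightarrow> int) set" where
  "cohomology_restrict K L p c =
     the_elem ((\<lambda>f. cohomology_class L p (restrict f (simplices L p))) ` c)"


section \<open>Double cohomology of moment-angle complexes\<close>

text \<open>\<open>hochster m K k l\<close> is \<open>H\<^sup>-\<^sup>k\<^sup>,\<^sup>2\<^sup>l(Z\<^sub>K)\<close> in its Hochster decomposition, for arbitrary
  integers \<open>k\<close> and \<open>l\<close>.\<close>

definition index_sets :: "nat \<Rightarrow> int \<Rightarrow> nat set set" where
  "index_sets m l = {I. I \<subseteq> {1..m} \<and> int (card I) = l}"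

definition hochster ::
  "nat \<Rightarrow> nat set set \<Rightarrow> int \<Rightarrow> int \<Rightarrow> (nat set \<Rightarrow> (nat set \<Rightarrow> int) set) monoid" where
  "hochster m K k l =
     sum_group (index_sets m l) (\<lambda>I. reduced_cohomology (full_subcomplex K I) (l - k - 1))"

text \<open>The differential \<open>d'\<close> from bidegree \<open>(-k, 2l)\<close> to \<open>(-k+1, 2l-2)\<close>. On the summand of \<open>I\<close> it
  is \<open>(-1)\<^sup>p\<^sup>+\<^sup>1 \<Sum>\<^sub>i \<epsilon>(i,I) \<psi>\<^sub>p\<^sub>;\<^sub>i\<^sub>,\<^sub>I\<close> with \<open>p = l-k-1\<close>; its component at \<open>J\<close> therefore collects
  the contributions of all \<open>I = J \<union> {i}\<close> with \<open>i \<notin> J\<close>. The groups being written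
  multiplicatively, signs appear as exponents.\<close>

definition double_differential ::
  "nat \<Rightarrow> nat set set \<Rightarrow> int \<Rightarrow> int \<Rightarrow>
   (nat set \<Rightarrow> (nat set \<Rightarrow> int) set) \<Rightarrow> (nat set \<Rightarrow> (nat set \<Rightarrow> int) set)" where
  "double_differential m K k l x =
     (let p = l - k - 1; sign = (if even (p + 1) then 1 else -1) in
      (\<lambda>J\<in>index_sets m (l - 1).
        finprod (reduced_cohomology (full_subcomplex K J) p)
          (\<lambda>i. cohomology_restrict (full_subcomplex K (insert i J)) (full_subcomplex K J) p
                  (x (insert i J))
                [^]\<^bsub>reduced_cohomology (full_subcomplex K J) p\<^esub>
                  (sign * incidence i (insert i J)))
          ({1..m} - J)))"

text \<open>\<open>HH m K k l\<close> is \<open>HH\<^sup>-\<^sup>k\<^sup>,\<^sup>2\<^sup>l(Z\<^sub>K)\<close>.\<close>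

definition HH ::
  "nat \<Rightarrow> nat set set \<Rightarrow> int \<Rightarrow> int \<Rightarrow> (nat set \<Rightarrow> (nat set \<Rightarrow> int) set) set monoid" where
  "HH m K k l =
     cohomology_at (hochster m K (k + 1) (l + 1)) (double_differential m K (k + 1) (l + 1))
       (hochster m K k l) (double_differential m K k l) (hochster m K (k - 1) (l - 1))"


section \<open>The definitions make sense\<close>

lemma simplicial_complex_boundary_simplex:
  "m \<ge> 1 \<Longrightarrow> simplicial_complex_on m (boundary_simplex m)"
  unfolding simplicial_complex_on_def boundary_simplex_def by auto

lemma simplicial_complex_full_subcomplex:
  "simplicial_complex_on m K \<Longrightarrow> simplicial_complex_on m (full_subcomplex K I)"
  unfolding simplicial_complex_on_def full_subcomplex_def by blast

lemma sum_antisymmetric: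
  fixes g :: "'a \<Rightarrow> 'a \<Rightarrow> int"
  assumes "finite A" and anti: "\<And>i j. i \<in> A \<Longrightarrow> j \<in> A \<Longrightarrow> i \<noteq> j \<Longrightarrow> g i j = - g j i"
  shows "(\<Sum>i\<in>A. \<Sum>j\<in>A - {i}. g i j) = 0"
proof -
  define h where "h i j = (if i = j then 0 else g i j)" for i j
  have S: "(\<Sum>i\<in>A. \<Sum>j\<in>A - {i}. g i j) = (\<Sum>i\<in>A. \<Sum>j\<in>A. h i j)"
  proof (rule sum.cong[OF refl])
    fix i assume "i \<in> A"
    have "(\<Sum>j\<in>A - {i}. g i j) = (\<Sum>j\<in>A - {i}. h i j)"
      by (rule sum.cong) (auto simp: h_def)
    also have "\<dots> = (\<Sum>j\<in>A. h i j)"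
      using assms(1) by (intro sum.mono_neutral_left) (auto simp: h_def)
    finally show "(\<Sum>j\<in>A - {i}. g i j) = (\<Sum>j\<in>A. h i j)" .
  qed
  have "(\<Sum>i\<in>A. \<Sum>j\<in>A. h i j) = (\<Sum>j\<in>A. \<Sum>i\<in>A. h i j)"
    by (rule sum.swap)
  also have "\<dots> = (\<Sum>j\<in>A. \<Sum>i\<in>A. - h j i)"
    by (intro sum.cong refl) (auto simp: h_def intro: anti)
  also have "\<dots> = - (\<Sum>i\<in>A. \<Sum>j\<in>A. h i j)"
    by (simp add: sum_negf)
  finally show ?thesis using S by simp
qed

lemma incidence_antisymmetric:
  assumes "finite J" "i \<in> J" "j \<in> J" "i \<noteq> j"
  shows "incidence i J * incidence j (J - {i}) = - (incidence j J * incidence i (J - {j}))"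
proof -
  have *: "incidence i J * incidence j (J - {i}) = - (incidence j J * incidence i (J - {j}))"
    if "i < j" "i \<in> J" "j \<in> J" for i j
  proof -
    have 1: "{r \<in> J - {j}. r < i} = {r \<in> J. r < i}" using that by auto
    have "{r \<in> J. r < j} = insert i {r \<in> J - {i}. r < j}" using that by auto
    then have "card {r \<in> J. r < j} = Suc (card {r \<in> J - {i}. r < j})"
      using assms(1) by simp
    then show ?thesis unfolding incidence_def 1 by simp
  qed
  show ?thesis
    using *[of i j] *[of j i] assms by (cases "i < j") auto
qed

lemma incidence_insert_antisymmetric:
  assumes "finite J" "i \<notin> J" "j \<notin> J" "i \<noteq> j"
  shows "incidence i (insert i J) * incidence j (insert j (insert i J)) =
    - (incidence j (insert j J) * incidence i (insert i (insert j J)))"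
proof -
  have 1: "insert j (insert i J) - {j} = insert i J" "insert j (insert i J) - {i} = insert j J"
    using assms by auto
  show ?thesis
    using incidence_antisymmetric[of "insert j (insert i J)" j i] assms
    unfolding 1 by (simp add: insert_commute mult.commute)
qed

lemma comm_group_subgroup:
  assumes "comm_group G" "subgroup H G"
  shows "comm_group (G\<lparr>carrier := H\<rparr>)"
proof -
  interpret comm_group G by fact
  show ?thesis
    using subgroup_imp_group[OF assms(2)] subgroup.mem_carrier[OF assms(2)]
    by (intro group.group_comm_groupI) (auto intro: m_comm)
qed

lemma comm_group_Mod:
  assumes "comm_group G" "subgroup H G"
  shows "comm_group (G Mod H)"
proof -
  interpret comm_group G by fact
  interpret normal H G by (rule subgroup_imp_normal[OF assms(2)])
  show ?thesis
    by (rule group.group_comm_groupI[OF factorgroup_is_group])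
      (auto simp: FactGroup_def RCOSETS_def rcos_sum m_comm)
qed

lemma comm_group_cohomology_at:
  assumes "comm_group A" "comm_group B" "comm_group C"
    and f: "f \<in> hom A B" and g: "g \<in> hom B C"
    and gf: "\<And>x. x \<in> carrier A \<Longrightarrow> g (f x) = \<one>\<^bsub>C\<^esub>"
  shows "comm_group (cohomology_at A f B g C)"
proof -
  interpret A: comm_group A by fact
  interpret B: comm_group B by fact
  interpret C: comm_group C by fact
  interpret F: group_hom A B f by unfold_locales (rule f)
  interpret G: group_hom B C g by unfold_locales (rule g)
  interpret Z: comm_group "B\<lparr>carrier := kernel B C g\<rparr>"
    by (rule comm_group_subgroup[OF B.comm_group_axioms G.subgroup_kernel])
  have "subgroup (f ` carrier A) (B\<lparr>carrier := kernel B C g\<rparr>)"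
  proof (rule B.subgroup_incl)
    show "subgroup (f ` carrier A) B" by (rule F.img_is_subgroup)
    show "subgroup (kernel B C g) B" by (rule G.subgroup_kernel)
    show "f ` carrier A \<subseteq> kernel B C g" using gf by (auto simp: kernel_def)
  qed
  then show ?thesis
    unfolding cohomology_at_def by (rule comm_group_Mod[OF Z.comm_group_axioms])
qed

lemma comm_group_product_group:
  assumes "\<And>i. i \<in> I \<Longrightarrow> comm_group (G i)"
  shows "comm_group (product_group I G)"
proof (rule group.group_comm_groupI)
  show "group (product_group I G)"
    using assms by (simp add: comm_group.axioms(2))
  fix x y assume "x \<in> carrier (product_group I G)" "y \<in> carrier (product_group I G)"
  then show "x \<otimes>\<^bsub>product_group I G\<^esub> y = y \<otimes>\<^bsub>product_group I G\<^esub> x"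
    using assms by (auto simp: PiE_iff comm_group_def intro!: restrict_ext comm_monoid.m_comm)
qed

lemma comm_group_sum_group:
  assumes "\<And>i. i \<in> I \<Longrightarrow> comm_group (G i)"
  shows "comm_group (sum_group I G)"
proof (rule group.group_comm_groupI)
  show "group (sum_group I G)"
    using assms by (simp add: comm_group.axioms(2))
  fix x y assume "x \<in> carrier (sum_group I G)" "y \<in> carrier (sum_group I G)"
  then show "x \<otimes>\<^bsub>sum_group I G\<^esub> y = y \<otimes>\<^bsub>sum_group I G\<^esub> x"
    using assms
    by (auto simp: PiE_iff carrier_sum_group comm_group.axioms(2) comm_group_def
        intro!: restrict_ext comm_monoid.m_comm)
qed

lemma comm_group_cochain_group: "comm_group (cochain_group K p)"
  unfolding cochain_group_def by (simp add: comm_group_product_group abelian_integer_group)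

lemma carrier_cochain_group: "carrier (cochain_group K p) = extensional (simplices K p)"
  by (auto simp: cochain_group_def PiE_def)

lemma mult_cochain_group:
  "f \<otimes>\<^bsub>cochain_group K p\<^esub> g = (\<lambda>J\<in>simplices K p. f J + g J)"
  by (simp add: cochain_group_def)

lemma one_cochain_group: "\<one>\<^bsub>cochain_group K p\<^esub> = (\<lambda>J\<in>simplices K p. 0)"
  by (simp add: cochain_group_def)

lemma simplices_face:
  assumes "simplicial_complex_on m K" "J \<in> simplices K (p + 1)" "j \<in> J"
  shows "J - {j} \<in> simplices K p" "finite J"
proof -
  have "J \<subseteq> {1..m}" using assms unfolding simplices_def simplicial_complex_on_def by auto
  then show fin: "finite J" by (rule finite_subset) simp
  have "J - {j} \<in> K"
    using assms unfolding simplices_def simplicial_complex_on_def by blast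
  moreover have "int (card (J - {j})) = int (card J) - 1"
    using fin assms(3) card_gt_0_iff[of J] by (auto simp: card_Diff_singleton of_nat_diff Suc_leI)
  ultimately show "J - {j} \<in> simplices K p"
    using assms by (auto simp: simplices_def)
qed

lemma coboundary_hom:
  assumes "simplicial_complex_on m K"
  shows "coboundary K p \<in> hom (cochain_group K p) (cochain_group K (p + 1))"
proof (rule homI)
  fix f g assume "f \<in> carrier (cochain_group K p)" "g \<in> carrier (cochain_group K p)"
  show "coboundary K p (f \<otimes>\<^bsub>cochain_group K p\<^esub> g) =
    coboundary K p f \<otimes>\<^bsub>cochain_group K (p + 1)\<^esub> coboundary K p g"
    unfolding mult_cochain_group coboundary_def
    using simplices_face[OF assms]
    by (auto simp: sum.distrib[symmetric] algebra_simps intro!: restrict_ext sum.cong)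
qed (auto simp: carrier_cochain_group coboundary_def)

lemma coboundary_coboundary:
  assumes "simplicial_complex_on m K"
  shows "coboundary K (p + 1) (coboundary K p f) = \<one>\<^bsub>cochain_group K (p + 1 + 1)\<^esub>"
  unfolding one_cochain_group coboundary_def[of K "p + 1"]
proof (rule restrict_ext)
  fix J assume J: "J \<in> simplices K (p + 1 + 1)"
  have fin: "finite J"
    using simplices_face(2)[OF assms J] by (cases "J = {}") auto
  have "(\<Sum>j\<in>J. incidence j J * coboundary K p f (J - {j})) =
     (\<Sum>j\<in>J. \<Sum>i\<in>J - {j}. incidence j J * incidence i (J - {j}) * f (J - {j} - {i}))"
    using simplices_face[OF assms J]
    by (auto simp: coboundary_def sum_distrib_left mult.assoc intro!: sum.cong)
  also have "\<dots> = 0"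
  proof (rule sum_antisymmetric[OF fin])
    fix i j assume "i \<in> J" "j \<in> J" "i \<noteq> j"
    then show "incidence i J * incidence j (J - {i}) * f (J - {i} - {j}) =
        - (incidence j J * incidence i (J - {j}) * f (J - {j} - {i}))"
      using incidence_antisymmetric[OF fin, of i j]
      by (simp add: Diff_insert2[symmetric] insert_commute)
  qed
  finally show "(\<Sum>j\<in>J. incidence j J * coboundary K p f (J - {j})) = 0" .
qed

lemma comm_group_reduced_cohomology:
  assumes "simplicial_complex_on m K"
  shows "comm_group (reduced_cohomology K p)"
  unfolding reduced_cohomology_def
  using coboundary_hom[OF assms, of "p - 1"] coboundary_hom[OF assms, of p]
    coboundary_coboundary[OF assms, of "p - 1"]
  by (intro comm_group_cohomology_at comm_group_cochain_group) auto

definition cocycles :: "nat set set \<Rightarrow> int \<Rightarrow> (nat set \<Rightarrow> int) set" where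
  "cocycles K p = kernel (cochain_group K p) (cochain_group K (p + 1)) (coboundary K p)"

lemma carrier_reduced_cohomology:
  "carrier (reduced_cohomology K p) = cohomology_class K p ` cocycles K p"
  by (auto simp: reduced_cohomology_def cohomology_at_def FactGroup_def RCOSETS_def
      cohomology_class_def cocycles_def r_coset_def)

lemma cohomology_class_hom:
  assumes "simplicial_complex_on m K"
  shows "group_hom ((cochain_group K p)\<lparr>carrier := cocycles K p\<rparr>) (reduced_cohomology K p)
           (cohomology_class K p)"
proof -
  interpret D: group_hom "cochain_group K p" "cochain_group K (p + 1)" "coboundary K p"
    using coboundary_hom[OF assms]
    by (simp add: group_hom_def group_hom_axioms_def comm_group.axioms(2)
        comm_group_cochain_group)
  interpret E: group_hom "cochain_group K (p - 1)" "cochain_group K p" "coboundary K (p - 1)"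
    using coboundary_hom[OF assms, of "p - 1"]
    by (simp add: group_hom_def group_hom_axioms_def comm_group.axioms(2)
        comm_group_cochain_group)
  interpret B: comm_group "cochain_group K p" by (rule comm_group_cochain_group)
  let ?Z = "(cochain_group K p)\<lparr>carrier := cocycles K p\<rparr>"
  let ?B = "coboundary K (p - 1) ` carrier (cochain_group K (p - 1))"
  interpret Z: comm_group ?Z
    unfolding cocycles_def
    by (rule comm_group_subgroup[OF B.comm_group_axioms D.subgroup_kernel])
  have "subgroup ?B ?Z"
    unfolding cocycles_def
  proof (rule group.subgroup_incl[OF comm_group.axioms(2)[OF comm_group_cochain_group]])
    show "subgroup ?B (cochain_group K p)" by (rule E.img_is_subgroup)
    show "subgroup (kernel (cochain_group K p) (cochain_group K (p + 1)) (coboundary K p))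
            (cochain_group K p)" by (rule D.subgroup_kernel)
    show "?B \<subseteq> kernel (cochain_group K p) (cochain_group K (p + 1)) (coboundary K p)"
      using coboundary_coboundary[OF assms, of "p - 1"] E.hom_closed by (auto simp: kernel_def)
  qed
  then have N: "?B \<lhd> ?Z" by (rule Z.subgroup_imp_normal)
  have "(\<lambda>f. ?B #>\<^bsub>?Z\<^esub> f) \<in> hom ?Z (?Z Mod ?B)"
    using normal.r_coset_hom_Mod[OF N] .
  moreover have "(\<lambda>f. ?B #>\<^bsub>?Z\<^esub> f) = cohomology_class K p"
    by (simp add: fun_eq_iff cohomology_class_def r_coset_def)
  moreover have "?Z Mod ?B = reduced_cohomology K p"
    by (simp add: reduced_cohomology_def cohomology_at_def cocycles_def)
  ultimately show ?thesis
    using comm_group_reduced_cohomology[OF assms, of p]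
    by (simp add: group_hom_def group_hom_axioms_def comm_group.axioms(2) Z.is_group)
qed

lemma one_cohomology_class:
  assumes "simplicial_complex_on m K" "b \<in> carrier (cochain_group K (p - 1))"
  shows "cohomology_class K p (coboundary K (p - 1) b) = \<one>\<^bsub>reduced_cohomology K p\<^esub>"
proof -
  let ?B = "coboundary K (p - 1) ` carrier (cochain_group K (p - 1))"
  interpret E: group_hom "cochain_group K (p - 1)" "cochain_group K p" "coboundary K (p - 1)"
    using coboundary_hom[OF assms(1), of "p - 1"]
    by (simp add: group_hom_def group_hom_axioms_def comm_group.axioms(2)
        comm_group_cochain_group)
  have "?B #>\<^bsub>cochain_group K p\<^esub> coboundary K (p - 1) b = ?B"
    using subgroup.rcos_const[OF E.img_is_subgroup E.H.is_group] assms(2) by blast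
  then show ?thesis
    by (simp add: cohomology_class_def reduced_cohomology_def cohomology_at_def FactGroup_def)
qed

lemma coboundary_cocycle:
  assumes "simplicial_complex_on m K" "b \<in> carrier (cochain_group K (p - 1))"
  shows "coboundary K (p - 1) b \<in> cocycles K p"
  using coboundary_coboundary[OF assms(1), of "p - 1" b]
    hom_carrier[OF coboundary_hom[OF assms(1), of "p - 1"]] assms(2)
  by (auto simp: cocycles_def kernel_def)

lemma coboundary_restrict:
  assumes "simplicial_complex_on m L" "L \<subseteq> K"
  shows "coboundary L p (restrict f (simplices L p)) =
    restrict (coboundary K p f) (simplices L (p + 1))"
proof -
  have "simplices L (p + 1) \<subseteq> simplices K (p + 1)"
    using assms(2) by (auto simp: simplices_def)
  then show ?thesis
    unfolding coboundary_def
    using simplices_face(1)[OF assms(1)]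
    by (auto simp: fun_eq_iff restrict_def intro!: sum.cong)
qed

lemma restrict_cocycle:
  assumes "simplicial_complex_on m L" "L \<subseteq> K" "f \<in> cocycles K p"
  shows "restrict f (simplices L p) \<in> cocycles L p"
proof -
  have "simplices L (p + 1) \<subseteq> simplices K (p + 1)"
    using assms(2) by (auto simp: simplices_def)
  then show ?thesis
    using assms(3) coboundary_restrict[OF assms(1,2), of p f]
    by (auto simp: cocycles_def kernel_def carrier_cochain_group one_cochain_group
        fun_eq_iff restrict_def extensional_def)
qed

lemma cohomology_restrict_class:
  assumes K: "simplicial_complex_on m K" and L: "simplicial_complex_on m L" "L \<subseteq> K"
    and f: "f \<in> cocycles K p"
  shows "cohomology_restrict K L p (cohomology_class K p f) =
    cohomology_class L p (restrict f (simplices L p))"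
proof -
  interpret H: group_hom "(cochain_group L p)\<lparr>carrier := cocycles L p\<rparr>"
      "reduced_cohomology L p" "cohomology_class L p"
    by (rule cohomology_class_hom[OF L(1)])
  have sub: "simplices L q \<subseteq> simplices K q" for q
    using L(2) by (auto simp: simplices_def)
  have "(\<lambda>f. cohomology_class L p (restrict f (simplices L p))) ` cohomology_class K p f =
    {cohomology_class L p (restrict f (simplices L p))}"
  proof -
    have "cohomology_class L p (restrict (coboundary K (p - 1) b \<otimes>\<^bsub>cochain_group K p\<^esub> f)
        (simplices L p)) = cohomology_class L p (restrict f (simplices L p))" for b
    proof -
      let ?b = "restrict b (simplices L (p - 1))"
      have b: "?b \<in> carrier (cochain_group L (p - 1))"
        by (simp add: carrier_cochain_group)
      have "restrict (coboundary K (p - 1) b \<otimes>\<^bsub>cochain_group K p\<^esub> f) (simplices L p) =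
        coboundary L (p - 1) ?b \<otimes>\<^bsub>cochain_group L p\<^esub> restrict f (simplices L p)"
        using sub[of p] unfolding coboundary_restrict[OF L]
        by (auto simp: mult_cochain_group fun_eq_iff restrict_def)
      then show ?thesis
        using H.hom_mult[of "coboundary L (p - 1) ?b" "restrict f (simplices L p)"]
          H.hom_closed[of "restrict f (simplices L p)"]
          coboundary_cocycle[OF L(1) b] restrict_cocycle[OF L f] one_cohomology_class[OF L(1) b]
        by simp
    qed
    moreover have "carrier (cochain_group K (p - 1)) \<noteq> {}"
      using monoid.one_closed comm_monoid.axioms(1) comm_group.axioms(1)[OF comm_group_cochain_group]
      by fastforce
    ultimately show ?thesis
      unfolding cohomology_class_def[of K] r_coset_def by (auto simp: image_iff)
  qed
  then show ?thesis by (simp add: cohomology_restrict_def)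
qed

lemma cohomology_class_combination:
  assumes "simplicial_complex_on m K" "finite A" "\<And>i. i \<in> A \<Longrightarrow> f i \<in> cocycles K p"
  shows "(\<lambda>J\<in>simplices K p. \<Sum>i\<in>A. n i * f i J) \<in> cocycles K p \<and>
    finprod (reduced_cohomology K p)
      (\<lambda>i. cohomology_class K p (f i) [^]\<^bsub>reduced_cohomology K p\<^esub> (n i :: int)) A =
    cohomology_class K p (\<lambda>J\<in>simplices K p. \<Sum>i\<in>A. n i * f i J)"
proof -
  let ?Z = "(cochain_group K p)\<lparr>carrier := cocycles K p\<rparr>"
  interpret H: group_hom ?Z "reduced_cohomology K p" "cohomology_class K p"
    by (rule cohomology_class_hom[OF assms(1)])
  interpret HC: comm_group "reduced_cohomology K p"
    by (rule comm_group_reduced_cohomology[OF assms(1)])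
  have scale: "(\<lambda>J\<in>simplices K p. n * f J) \<in> cocycles K p \<and>
      cohomology_class K p f [^]\<^bsub>reduced_cohomology K p\<^esub> n =
      cohomology_class K p (\<lambda>J\<in>simplices K p. n * f J)"
    if f: "f \<in> cocycles K p" for f and n :: int
  proof -
    let ?h = "\<lambda>n::int. \<lambda>J\<in>simplices K p. n * f J"
    have ex: "f \<in> extensional (simplices K p)"
      using f by (auto simp: cocycles_def kernel_def carrier_cochain_group)
    have cob: "coboundary K p f = (\<lambda>J\<in>simplices K (p + 1). 0)"
      using f by (simp add: cocycles_def kernel_def one_cochain_group)
    have "coboundary K p (?h n) = (\<lambda>J\<in>simplices K (p + 1). 0)" for n
    proof -
      have "coboundary K p (?h n) = (\<lambda>J\<in>simplices K (p + 1). n * coboundary K p f J)"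
        unfolding coboundary_def
        using simplices_face(1)[OF assms(1)]
        by (auto simp: fun_eq_iff restrict_def sum_distrib_left algebra_simps intro!: sum.cong)
      then show ?thesis unfolding cob by (auto simp: fun_eq_iff restrict_def)
    qed
    then have Z: "?h n \<in> cocycles K p" for n
      by (auto simp: cocycles_def kernel_def carrier_cochain_group one_cochain_group)
    have "?h \<in> hom integer_group ?Z"
      using Z by (auto simp: hom_def mult_cochain_group algebra_simps intro!: restrict_ext)
    then have "?h (1 [^]\<^bsub>integer_group\<^esub> n) = ?h 1 [^]\<^bsub>?Z\<^esub> n"
      by (rule hom_int_pow) (auto simp: H.is_group)
    moreover have "?h 1 = f"
      using extensional_restrict[OF ex] by (simp add: restrict_def)
    ultimately have "f [^]\<^bsub>?Z\<^esub> n = ?h n" by simp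
    then show ?thesis
      using H.hom_int_pow[of f n] f Z by simp
  qed
  show ?thesis
    using assms(2,3)
  proof (induction A rule: finite_induct)
    case empty
    have "(\<lambda>J\<in>simplices K p. 0) = \<one>\<^bsub>?Z\<^esub>"
      by (simp add: one_cochain_group)
    then show ?case
      using H.G.one_closed H.hom_one by simp
  next
    case (insert a A)
    let ?S = "\<lambda>J\<in>simplices K p. \<Sum>i\<in>A. n i * f i J"
    let ?T = "\<lambda>J\<in>simplices K p. n a * f a J"
    have S: "?S \<in> cocycles K p"
      using insert.IH insert.prems by blast
    have T: "?T \<in> cocycles K p"
      using insert.prems scale by blast
    have eq: "(\<lambda>J\<in>simplices K p. \<Sum>i\<in>insert a A. n i * f i J) = ?T \<otimes>\<^bsub>cochain_group K p\<^esub> ?S"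
      using insert by (auto simp: mult_cochain_group intro!: restrict_ext)
    have cl: "cohomology_class K p (f i) [^]\<^bsub>reduced_cohomology K p\<^esub> n i
        \<in> carrier (reduced_cohomology K p)" if "i \<in> insert a A" for i
      using insert.prems[OF that] H.hom_closed by simp
    let ?P = "\<lambda>i. cohomology_class K p (f i) [^]\<^bsub>reduced_cohomology K p\<^esub> n i"
    have "finprod (reduced_cohomology K p) ?P (insert a A) =
      ?P a \<otimes>\<^bsub>reduced_cohomology K p\<^esub> finprod (reduced_cohomology K p) ?P A"
      using insert.hyps cl by (intro HC.finprod_insert) auto
    also have "?P a = cohomology_class K p ?T"
      using insert.prems scale by blast
    also have "finprod (reduced_cohomology K p) ?P A = cohomology_class K p ?S"
      using insert.IH insert.prems by blast
    finally have "finprod (reduced_cohomology K p) ?P (insert a A) =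
      cohomology_class K p ?T \<otimes>\<^bsub>reduced_cohomology K p\<^esub> cohomology_class K p ?S" .
    then show ?case
      unfolding eq using H.hom_mult[of ?T ?S] S T H.G.m_closed[of ?T ?S] by simp
  qed
qed

lemma finite_index_sets: "finite (index_sets m l)"
  by (rule finite_subset[of _ "Pow {1..m}"]) (auto simp: index_sets_def)

lemma comm_group_hochster:
  assumes "simplicial_complex_on m K"
  shows "comm_group (hochster m K k l)"
  unfolding hochster_def
  by (intro comm_group_sum_group
      comm_group_reduced_cohomology[OF simplicial_complex_full_subcomplex[OF assms]])

lemma carrier_hochster:
  assumes "simplicial_complex_on m K"
  shows "carrier (hochster m K k l) =
    (\<Pi>\<^sub>E I\<in>index_sets m l. carrier (reduced_cohomology (full_subcomplex K I) (l - k - 1)))"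
proof -
  have "group (reduced_cohomology (full_subcomplex K I) p)" for I p
    by (rule comm_group.axioms(2))
      (rule comm_group_reduced_cohomology[OF simplicial_complex_full_subcomplex[OF assms]])
  then show ?thesis
    unfolding hochster_def by (simp add: carrier_sum_group finite_index_sets)
qed

text \<open>The differential on the level of representing cocycles.\<close>

definition double_cochain ::
  "nat \<Rightarrow> nat set set \<Rightarrow> int \<Rightarrow> (nat set \<Rightarrow> nat set \<Rightarrow> int) \<Rightarrow> nat set \<Rightarrow> nat set \<Rightarrow> int" where
  "double_cochain m K p F J =
     (\<lambda>\<sigma>\<in>simplices (full_subcomplex K J) p. \<Sum>i\<in>{1..m} - J.
        (if even (p + 1) then 1 else -1) * incidence i (insert i J) * F (insert i J) \<sigma>)"

lemma insert_index_sets: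
  assumes "J \<in> index_sets m (l - 1)" "i \<in> {1..m} - J"
  shows "insert i J \<in> index_sets m l"
  using assms finite_subset[of J "{1..m}"] by (auto simp: index_sets_def)

lemma double_differential_class:
  assumes K: "simplicial_complex_on m K"
    and F: "\<And>I. I \<in> index_sets m l \<Longrightarrow> F I \<in> cocycles (full_subcomplex K I) (l - k - 1)"
    and J: "J \<in> index_sets m (l - 1)"
  shows "double_cochain m K (l - k - 1) F J \<in> cocycles (full_subcomplex K J) (l - k - 1)"
    and "x \<in> extensional (index_sets m l) \<Longrightarrow>
      (\<And>I. I \<in> index_sets m l \<Longrightarrow> x I = cohomology_class (full_subcomplex K I) (l - k - 1) (F I)) \<Longrightarrow>
      double_differential m K k l x J =
      cohomology_class (full_subcomplex K J) (l - k - 1) (double_cochain m K (l - k - 1) F J)"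
proof -
  let ?p = "l - k - 1"
  let ?L = "full_subcomplex K J"
  let ?s = "if even (?p + 1) then 1 else -1 :: int"
  let ?f = "\<lambda>i. restrict (F (insert i J)) (simplices ?L ?p)"
  note L = simplicial_complex_full_subcomplex[OF K]
  have sub: "?L \<subseteq> full_subcomplex K (insert i J)" for i
    by (auto simp: full_subcomplex_def)
  have ext: "(\<lambda>\<sigma>\<in>simplices ?L ?p. \<Sum>i\<in>{1..m} - J. (?s * incidence i (insert i J)) * ?f i \<sigma>) =
      double_cochain m K ?p F J"
    by (auto simp: double_cochain_def intro!: restrict_ext sum.cong)
  have f: "?f i \<in> cocycles ?L ?p" if "i \<in> {1..m} - J" for i
    using restrict_cocycle[OF L sub F[OF insert_index_sets[OF J that]]] .
  note comb = cohomology_class_combination[OF L[of J], of "{1..m} - J" ?f ?p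
      "\<lambda>i. ?s * incidence i (insert i J)", unfolded ext]
  show "double_cochain m K ?p F J \<in> cocycles ?L ?p"
    using comb f by simp
  assume x: "\<And>I. I \<in> index_sets m l \<Longrightarrow> x I = cohomology_class (full_subcomplex K I) ?p (F I)"
  interpret H: comm_group "reduced_cohomology ?L ?p"
    by (rule comm_group_reduced_cohomology[OF L])
  have "double_differential m K k l x J =
    finprod (reduced_cohomology ?L ?p)
      (\<lambda>i. cohomology_restrict (full_subcomplex K (insert i J)) ?L ?p (x (insert i J))
        [^]\<^bsub>reduced_cohomology ?L ?p\<^esub> (?s * incidence i (insert i J))) ({1..m} - J)"
    using J by (simp add: double_differential_def Let_def)
  also have "\<dots> = finprod (reduced_cohomology ?L ?p)
      (\<lambda>i. cohomology_class ?L ?p (?f i)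
        [^]\<^bsub>reduced_cohomology ?L ?p\<^esub> (?s * incidence i (insert i J))) ({1..m} - J)"
  proof (rule H.finprod_cong')
    show "(\<lambda>i. cohomology_class ?L ?p (?f i)
        [^]\<^bsub>reduced_cohomology ?L ?p\<^esub> (?s * incidence i (insert i J)))
        \<in> {1..m} - J \<rightarrow> carrier (reduced_cohomology ?L ?p)"
      using f by (intro Pi_I group.int_pow_closed[OF H.is_group]) (auto simp: carrier_reduced_cohomology)
    fix i assume i: "i \<in> {1..m} - J"
    show "cohomology_restrict (full_subcomplex K (insert i J)) ?L ?p (x (insert i J))
        [^]\<^bsub>reduced_cohomology ?L ?p\<^esub> (?s * incidence i (insert i J)) =
      cohomology_class ?L ?p (?f i)
        [^]\<^bsub>reduced_cohomology ?L ?p\<^esub> (?s * incidence i (insert i J))"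
      using cohomology_restrict_class[OF L L sub F[OF insert_index_sets[OF J i]]]
        x[OF insert_index_sets[OF J i]] by simp
  qed simp
  also have "\<dots> = cohomology_class ?L ?p (double_cochain m K ?p F J)"
    using comb f by simp
  finally show "double_differential m K k l x J =
    cohomology_class ?L ?p (double_cochain m K ?p F J)" .
qed

lemma hochster_representatives:
  assumes "simplicial_complex_on m K" "x \<in> carrier (hochster m K k l)"
  obtains F where
    "\<And>I. I \<in> index_sets m l \<Longrightarrow> F I \<in> cocycles (full_subcomplex K I) (l - k - 1)"
    "\<And>I. I \<in> index_sets m l \<Longrightarrow> x I = cohomology_class (full_subcomplex K I) (l - k - 1) (F I)"
    "x \<in> extensional (index_sets m l)"
proof -
  have "\<forall>I\<in>index_sets m l. \<exists>f. f \<in> cocycles (full_subcomplex K I) (l - k - 1) \<and>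
      x I = cohomology_class (full_subcomplex K I) (l - k - 1) f"
    using assms(2) unfolding carrier_hochster[OF assms(1)] carrier_reduced_cohomology by fastforce
  then obtain F where "\<forall>I\<in>index_sets m l. F I \<in> cocycles (full_subcomplex K I) (l - k - 1) \<and>
      x I = cohomology_class (full_subcomplex K I) (l - k - 1) (F I)"
    by metis
  moreover have "x \<in> extensional (index_sets m l)"
    using assms(2) unfolding carrier_hochster[OF assms(1)] by (auto simp: PiE_def)
  ultimately show ?thesis using that by blast
qed

lemma double_differential_hom:
  assumes K: "simplicial_complex_on m K"
  shows "double_differential m K k l \<in> hom (hochster m K k l) (hochster m K (k - 1) (l - 1))"
proof (rule homI)
  note L = simplicial_complex_full_subcomplex[OF K]
  have p: "(l - 1) - (k - 1) - 1 = l - k - 1" by simp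
  have ext: "double_differential m K k l x \<in> extensional (index_sets m (l - 1))" for x
    by (simp add: double_differential_def Let_def)
  show "double_differential m K k l x \<in> carrier (hochster m K (k - 1) (l - 1))"
    if x: "x \<in> carrier (hochster m K k l)" for x
  proof -
    obtain F where F: "\<And>I. I \<in> index_sets m l \<Longrightarrow> F I \<in> cocycles (full_subcomplex K I) (l - k - 1)"
      "\<And>I. I \<in> index_sets m l \<Longrightarrow> x I = cohomology_class (full_subcomplex K I) (l - k - 1) (F I)"
      "x \<in> extensional (index_sets m l)"
      using hochster_representatives[OF K x] by blast
    show ?thesis
      unfolding carrier_hochster[OF K] p carrier_reduced_cohomology
      using ext double_differential_class[OF K F(1)] F by (auto simp: PiE_iff)
  qed
  fix x y assume x: "x \<in> carrier (hochster m K k l)" and y: "y \<in> carrier (hochster m K k l)"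
  obtain F where F: "\<And>I. I \<in> index_sets m l \<Longrightarrow> F I \<in> cocycles (full_subcomplex K I) (l - k - 1)"
    "\<And>I. I \<in> index_sets m l \<Longrightarrow> x I = cohomology_class (full_subcomplex K I) (l - k - 1) (F I)"
    "x \<in> extensional (index_sets m l)"
    using hochster_representatives[OF K x] by blast
  obtain G where G: "\<And>I. I \<in> index_sets m l \<Longrightarrow> G I \<in> cocycles (full_subcomplex K I) (l - k - 1)"
    "\<And>I. I \<in> index_sets m l \<Longrightarrow> y I = cohomology_class (full_subcomplex K I) (l - k - 1) (G I)"
    "y \<in> extensional (index_sets m l)"
    using hochster_representatives[OF K y] by blast
  let ?p = "l - k - 1"
  define FG where "FG I = F I \<otimes>\<^bsub>cochain_group (full_subcomplex K I) ?p\<^esub> G I" for I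
  let ?xy = "x \<otimes>\<^bsub>hochster m K k l\<^esub> y"
  have FG: "FG I \<in> cocycles (full_subcomplex K I) ?p"
    "?xy I = cohomology_class (full_subcomplex K I) ?p (FG I)" if "I \<in> index_sets m l" for I
  proof -
    interpret H: group_hom "(cochain_group (full_subcomplex K I) ?p)
        \<lparr>carrier := cocycles (full_subcomplex K I) ?p\<rparr>"
      "reduced_cohomology (full_subcomplex K I) ?p" "cohomology_class (full_subcomplex K I) ?p"
      by (rule cohomology_class_hom[OF L])
    show "FG I \<in> cocycles (full_subcomplex K I) ?p"
      using H.G.m_closed F(1)[OF that] G(1)[OF that] by (simp add: FG_def)
    show "?xy I = cohomology_class (full_subcomplex K I) ?p (FG I)"
      using H.hom_mult F(1,2)[OF that] G(1,2)[OF that] that by (simp add: FG_def hochster_def)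
  qed
  have xy_ext: "?xy \<in> extensional (index_sets m l)" by (simp add: hochster_def)
  show "double_differential m K k l ?xy =
    double_differential m K k l x \<otimes>\<^bsub>hochster m K (k - 1) (l - 1)\<^esub> double_differential m K k l y"
  proof (rule extensionalityI[OF ext])
    show "double_differential m K k l x \<otimes>\<^bsub>hochster m K (k - 1) (l - 1)\<^esub>
        double_differential m K k l y \<in> extensional (index_sets m (l - 1))"
      by (simp add: hochster_def)
    fix J assume J: "J \<in> index_sets m (l - 1)"
    interpret H: group_hom "(cochain_group (full_subcomplex K J) ?p)
        \<lparr>carrier := cocycles (full_subcomplex K J) ?p\<rparr>"
      "reduced_cohomology (full_subcomplex K J) ?p" "cohomology_class (full_subcomplex K J) ?p"
      by (rule cohomology_class_hom[OF L])
    have "double_cochain m K ?p FG J = double_cochain m K ?p F J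
        \<otimes>\<^bsub>cochain_group (full_subcomplex K J) ?p\<^esub> double_cochain m K ?p G J"
    proof -
      have "\<sigma> \<in> simplices (full_subcomplex K (insert i J)) ?p"
        if "\<sigma> \<in> simplices (full_subcomplex K J) ?p" for \<sigma> i
        using that by (auto simp: simplices_def full_subcomplex_def)
      then show ?thesis
        unfolding double_cochain_def mult_cochain_group FG_def
        by (auto simp: sum.distrib[symmetric] algebra_simps intro!: restrict_ext sum.cong)
    qed
    moreover have "double_differential m K k l x J =
      cohomology_class (full_subcomplex K J) ?p (double_cochain m K ?p F J)"
      by (rule double_differential_class(2)[OF K _ J]) (use F in auto)
    moreover have "double_differential m K k l y J =
      cohomology_class (full_subcomplex K J) ?p (double_cochain m K ?p G J)"
      by (rule double_differential_class(2)[OF K _ J]) (use G in auto)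
    moreover have "double_differential m K k l ?xy J =
      cohomology_class (full_subcomplex K J) ?p (double_cochain m K ?p FG J)"
      by (rule double_differential_class(2)[OF K _ J]) (use FG xy_ext in auto)
    moreover have "double_cochain m K ?p F J \<in> cocycles (full_subcomplex K J) ?p"
      "double_cochain m K ?p G J \<in> cocycles (full_subcomplex K J) ?p"
      by (rule double_differential_class(1)[OF K _ J], use F G in auto)+
    ultimately have "double_differential m K k l ?xy J =
      double_differential m K k l x J \<otimes>\<^bsub>reduced_cohomology (full_subcomplex K J) ?p\<^esub>
        double_differential m K k l y J"
      using H.hom_mult[of "double_cochain m K ?p F J" "double_cochain m K ?p G J"] by simp
    then show "double_differential m K k l ?xy J =
      (double_differential m K k l x \<otimes>\<^bsub>hochster m K (k - 1) (l - 1)\<^esub>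
        double_differential m K k l y) J"
      using J by (simp add: hochster_def p)
  qed
qed

lemma double_differential_square:
  assumes K: "simplicial_complex_on m K" and x: "x \<in> carrier (hochster m K k l)"
  shows "double_differential m K (k - 1) (l - 1) (double_differential m K k l x) =
    \<one>\<^bsub>hochster m K (k - 1 - 1) (l - 1 - 1)\<^esub>"
proof (rule extensionalityI)
  note L = simplicial_complex_full_subcomplex[OF K]
  let ?p = "l - k - 1" and ?A = "index_sets m (l - 1 - 1)"
  show "double_differential m K (k - 1) (l - 1) (double_differential m K k l x) \<in> extensional ?A"
    by (simp add: double_differential_def Let_def)
  show "\<one>\<^bsub>hochster m K (k - 1 - 1) (l - 1 - 1)\<^esub> \<in> extensional ?A"
    by (simp add: hochster_def)
  have p: "(l - 1) - (k - 1) - 1 = ?p" by simp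
  obtain F where F: "\<And>I. I \<in> index_sets m l \<Longrightarrow> F I \<in> cocycles (full_subcomplex K I) ?p"
    "\<And>I. I \<in> index_sets m l \<Longrightarrow> x I = cohomology_class (full_subcomplex K I) ?p (F I)"
    "x \<in> extensional (index_sets m l)"
    using hochster_representatives[OF K x] by blast
  let ?F = "double_cochain m K ?p F"
  fix J assume J: "J \<in> ?A"
  have finJ: "finite J" using J by (auto simp: index_sets_def intro: finite_subset)
  interpret H: group_hom "(cochain_group (full_subcomplex K J) ?p)
      \<lparr>carrier := cocycles (full_subcomplex K J) ?p\<rparr>"
    "reduced_cohomology (full_subcomplex K J) ?p" "cohomology_class (full_subcomplex K J) ?p"
    by (rule cohomology_class_hom[OF L])
  have "double_differential m K (k - 1) (l - 1) (double_differential m K k l x) J =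
    cohomology_class (full_subcomplex K J) ?p (double_cochain m K ?p ?F J)"
  proof (rule double_differential_class(2)[OF K, of "l - 1" ?F "k - 1" J, unfolded p])
    show "double_differential m K k l x \<in> extensional (index_sets m (l - 1))"
      by (simp add: double_differential_def Let_def)
    show "?F I \<in> cocycles (full_subcomplex K I) ?p" if "I \<in> index_sets m (l - 1)" for I
      by (rule double_differential_class(1)[OF K _ that]) (use F in auto)
    show "double_differential m K k l x I = cohomology_class (full_subcomplex K I) ?p (?F I)"
      if "I \<in> index_sets m (l - 1)" for I
      by (rule double_differential_class(2)[OF K _ that]) (use F in auto)
  qed (rule J)
  also have "double_cochain m K ?p ?F J = \<one>\<^bsub>cochain_group (full_subcomplex K J) ?p\<^esub>"
    unfolding one_cochain_group double_cochain_def[of m K ?p ?F J]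
  proof (rule restrict_ext)
    fix \<sigma> assume \<sigma>: "\<sigma> \<in> simplices (full_subcomplex K J) ?p"
    let ?s = "if even (?p + 1) then 1 else -1 :: int"
    let ?g = "\<lambda>i j. ?s * incidence i (insert i J) *
      (?s * incidence j (insert j (insert i J)) * F (insert j (insert i J)) \<sigma>)"
    have "?F (insert i J) \<sigma> = (\<Sum>j\<in>{1..m} - insert i J.
        ?s * incidence j (insert j (insert i J)) * F (insert j (insert i J)) \<sigma>)" for i
      using \<sigma> by (auto simp: double_cochain_def simplices_def full_subcomplex_def)
    moreover have "{1..m} - insert i J = {1..m} - J - {i}" for i by auto
    ultimately have "(\<Sum>i\<in>{1..m} - J. ?s * incidence i (insert i J) * ?F (insert i J) \<sigma>) =
      (\<Sum>i\<in>{1..m} - J. \<Sum>j\<in>{1..m} - J - {i}. ?g i j)"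
      by (simp only: sum_distrib_left)
    also have "\<dots> = 0"
    proof (rule sum_antisymmetric)
      fix i j assume "i \<in> {1..m} - J" "j \<in> {1..m} - J" "i \<noteq> j"
      then have inc: "incidence i (insert i J) * incidence j (insert j (insert i J)) =
          - (incidence j (insert j J) * incidence i (insert i (insert j J)))"
        by (intro incidence_insert_antisymmetric[OF finJ]) auto
      have scale: "s * a * (s * b * x) = - (s * c * (s * d * x))"
        if "a * b = - (c * d)" for s a b c d x :: int
      proof -
        have "s * a * (s * b * x) = s * s * x * (a * b)" by (simp add: algebra_simps)
        also have "\<dots> = - (s * s * x * (c * d))" unfolding that by simp
        also have "s * s * x * (c * d) = s * c * (s * d * x)" by (simp add: algebra_simps)
        finally show ?thesis .
      qed
      show "?g i j = - ?g j i"
        using scale[OF inc, of ?s "F (insert j (insert i J)) \<sigma>"]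
        by (simp only: insert_commute[of i j])
    qed simp
    finally show "(\<Sum>i\<in>{1..m} - J. ?s * incidence i (insert i J) * ?F (insert i J) \<sigma>) = 0" .
  qed
  also have "cohomology_class (full_subcomplex K J) ?p
      \<one>\<^bsub>cochain_group (full_subcomplex K J) ?p\<^esub> =
      \<one>\<^bsub>hochster m K (k - 1 - 1) (l - 1 - 1)\<^esub> J"
    using H.hom_one J by (simp add: hochster_def)
  finally show "double_differential m K (k - 1) (l - 1) (double_differential m K k l x) J =
      \<one>\<^bsub>hochster m K (k - 1 - 1) (l - 1 - 1)\<^esub> J" .
qed

lemma comm_group_HH:
  assumes "simplicial_complex_on m K"
  shows "comm_group (HH m K k l)"
  unfolding HH_def
  using double_differential_hom[OF assms, of "k + 1" "l + 1"] double_differential_hom[OF assms, of k l]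
    double_differential_square[OF assms, of _ "k + 1" "l + 1"]
  by (intro comm_group_cohomology_at comm_group_hochster assms) auto

end

theory Submission
  imports Defs
begin

text \<open>
  For \<open>I\<close> a proper nonempty subset of \<open>[m]\<close>, the full subcomplex on \<open>I\<close> of the boundary of the
  simplex is the whole simplex on \<open>I\<close>, a cone, and so has no reduced cohomology
  (\<open>trivial_reduced_cohomology_cone\<close>). Only \<open>I = {}\<close> and \<open>I = [m]\<close> can therefore contribute to the
  Hochster decomposition. Both give boundaries of simplices: the sphere of dimension \<open>m - 2\<close> for
  \<open>I = [m]\<close>, and for \<open>I = {}\<close> the complex whose only simplex is the empty one, which is the boundary
  of a point. The boundary of the simplex on a nonempty set \<open>V\<close> has a single nonzero reduced
  cohomology group, \<open>\<int>\<close> in degree \<open>|V| - 2\<close> (\<open>reduced_cohomology_proper_subsets_trivial\<close>,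
  \<open>reduced_cohomology_proper_subsets_top\<close>). Solving \<open>l - k - 1 = |V| - 2\<close> places these two copies of
  \<open>\<int>\<close> at \<open>(k, l) = (0, 0)\<close> and \<open>(k, l) = (1, m)\<close>.

  The differential lowers both \<open>k\<close> and \<open>l\<close> by one. It can connect the two places only if \<open>m = 1\<close>; so
  for \<open>m \<ge> 2\<close> it vanishes, and the double cohomology is the Hochster decomposition itself
  (\<open>HH_iso_hochster\<close>).
\<close>

section \<open>Cohomology of cones\<close>

lemma incidence_square: "incidence i J * incidence i J = 1"
  by (simp add: incidence_def power_mult_distrib[symmetric])

text \<open>The cochain \<open>b\<close> is the contraction of \<open>f\<close> with the apex \<open>v\<close>. On a simplex containing \<open>v\<close>,
  only the face opposite to \<open>v\<close> contributes to the coboundary of \<open>b\<close>, and it contributes the value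
  of \<open>f\<close>. On a simplex \<open>J\<close> without \<open>v\<close>, the coboundary of \<open>b\<close> is, up to sign, the coboundary of
  \<open>f\<close> at \<open>insert v J\<close> with the term of \<open>f J\<close> left out; since \<open>f\<close> is a cocycle, this sum is the
  missing term.\<close>

lemma cone_cocycle_is_coboundary:
  assumes K: "simplicial_complex_on m K"
    and cone: "\<And>J. J \<in> K \<Longrightarrow> insert v J \<in> K"
    and f: "f \<in> cocycles K p"
  obtains b where "b \<in> carrier (cochain_group K (p - 1))" "f = coboundary K (p - 1) b"
proof -
  define b where "b = (\<lambda>J\<in>simplices K (p - 1).
    if v \<in> J then 0 else incidence v (insert v J) * f (insert v J))"
  have fin: "finite J" if "J \<in> K" for J
    using K that finite_subset[of J "{1..m}"] by (auto simp: simplicial_complex_on_def)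
  have face: "J - {j} \<in> simplices K (p - 1)" if "J \<in> simplices K p" "j \<in> J" for J j
    using simplices_face(1)[OF K, of J "p - 1" j] that by simp
  have "f J = coboundary K (p - 1) b J" if J: "J \<in> simplices K p" for J
  proof (cases "v \<in> J")
    case True
    have finJ: "finite J" using J fin by (simp add: simplices_def)
    have "(\<Sum>j\<in>J. incidence j J * b (J - {j})) = (\<Sum>j\<in>{v}. incidence j J * b (J - {j}))"
      using True face[OF J] finJ by (intro sum.mono_neutral_right) (auto simp: b_def)
    also have "\<dots> = (incidence v J * incidence v J) * f J"
      using True face[OF J True] by (simp add: b_def insert_absorb)
    finally show ?thesis
      using J by (simp add: coboundary_def incidence_square)
  next
    case False
    let ?S = "insert v J"
    have finJ: "finite J" and JK: "J \<in> K" using J fin by (simp_all add: simplices_def)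
    have S: "?S \<in> simplices K (p + 1)"
      using J cone[OF JK] False finJ by (simp add: simplices_def)
    have Sj: "insert v (J - {j}) = ?S - {j}" if "j \<in> J" for j
      using False that by auto
    have SJ: "?S - {v} = J" using False by auto
    \<comment> \<open>The cocycle condition at \<open>?S\<close>, solved for the term that belongs to the face \<open>J\<close>.\<close>
    have "coboundary K p f ?S = 0"
      using f S by (simp add: cocycles_def kernel_def one_cochain_group)
    then have cyc: "(\<Sum>j\<in>J. incidence j ?S * f (?S - {j})) = - (incidence v ?S * f J)"
      using S False finJ SJ by (simp add: coboundary_def)
    have "coboundary K (p - 1) b J = (\<Sum>j\<in>J. incidence j J * b (J - {j}))"
      using J by (simp add: coboundary_def)
    also have "\<dots> = (\<Sum>j\<in>J. - (incidence v ?S * (incidence j ?S * f (?S - {j}))))"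
    proof (rule sum.cong[OF refl])
      fix j assume j: "j \<in> J"
      have jv: "j \<noteq> v" using j False by auto
      have "incidence v ?S * incidence j J = - (incidence j ?S * incidence v (?S - {j}))"
        using incidence_antisymmetric[of ?S v j] finJ j jv SJ by simp
      then have "incidence v ?S * incidence v ?S * incidence j J * incidence v (?S - {j}) =
          - (incidence v ?S * incidence j ?S * (incidence v (?S - {j}) * incidence v (?S - {j})))"
        by (simp add: mult.assoc)
      then have "incidence j J * incidence v (?S - {j}) = - (incidence v ?S * incidence j ?S)"
        by (simp add: incidence_square)
      then have "incidence j J * incidence v (?S - {j}) * f (?S - {j}) =
          - (incidence v ?S * incidence j ?S) * f (?S - {j})" by simp
      moreover have "b (J - {j}) = incidence v (?S - {j}) * f (?S - {j})"
        using face[OF J j] False Sj[OF j] by (simp add: b_def)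
      ultimately show "incidence j J * b (J - {j}) = - (incidence v ?S * (incidence j ?S * f (?S - {j})))"
        by (simp add: mult.assoc)
    qed
    also have "\<dots> = - (incidence v ?S * (\<Sum>j\<in>J. incidence j ?S * f (?S - {j})))"
      by (simp add: sum_negf sum_distrib_left)
    also have "\<dots> = (incidence v ?S * incidence v ?S) * f J"
      unfolding cyc by simp
    finally show ?thesis by (simp add: incidence_square)
  qed
  moreover have "f \<in> extensional (simplices K p)"
    using f by (simp add: cocycles_def kernel_def carrier_cochain_group)
  ultimately have "f = coboundary K (p - 1) b"
    by (intro extensionalityI[of f "simplices K p"]) (auto simp: coboundary_def)
  moreover have "b \<in> carrier (cochain_group K (p - 1))"
    by (simp add: b_def carrier_cochain_group)
  ultimately show ?thesis using that by blast
qed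

lemma trivial_reduced_cohomologyI:
  assumes K: "simplicial_complex_on m K"
    and exact: "cocycles K p \<subseteq> coboundary K (p - 1) ` carrier (cochain_group K (p - 1))"
  shows "trivial_group (reduced_cohomology K p)"
proof -
  interpret H: comm_group "reduced_cohomology K p"
    by (rule comm_group_reduced_cohomology[OF K])
  show ?thesis
    unfolding H.trivial_group_subset carrier_reduced_cohomology
    using exact one_cohomology_class[OF K] by auto
qed

lemma trivial_reduced_cohomology_cone:
  assumes "simplicial_complex_on m K" "\<And>J. J \<in> K \<Longrightarrow> insert v J \<in> K"
  shows "trivial_group (reduced_cohomology K p)"
  using cone_cocycle_is_coboundary[OF assms, where ?p = p]
  by (intro trivial_reduced_cohomologyI[OF assms(1)]) blast


section \<open>Cohomology of the boundary of a simplex\<close>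

lemma simplicial_complex_Pow: "V \<subseteq> {1..m} \<Longrightarrow> simplicial_complex_on m (Pow V)"
  by (auto simp: simplicial_complex_on_def)

lemma simplicial_complex_proper_subsets:
  "V \<subseteq> {1..m} \<Longrightarrow> V \<noteq> {} \<Longrightarrow> simplicial_complex_on m {J. J \<subset> V}"
  by (auto simp: simplicial_complex_on_def)

lemma simplices_proper_subsets:
  assumes "finite V"
  shows "p < int (card V) - 1 \<Longrightarrow> simplices {J. J \<subset> V} p = simplices (Pow V) p"
    and "p \<ge> int (card V) - 1 \<Longrightarrow> simplices {J. J \<subset> V} p = {}"
proof -
  show "simplices {J. J \<subset> V} p = simplices (Pow V) p" if "p < int (card V) - 1"
    using that by (auto simp: simplices_def)
  show "simplices {J. J \<subset> V} p = {}" if "p \<ge> int (card V) - 1"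
    using that by (auto simp: simplices_def dest!: psubset_card_mono[OF assms])
qed

text \<open>Below degree \<open>|V| - 2\<close> the complex of proper subsets has the same cochains, up to one degree
  further, as the full simplex, which is a cone. Above that degree there are no simplices.\<close>

lemma reduced_cohomology_proper_subsets_trivial:
  assumes V: "V \<subseteq> {1..m}" "V \<noteq> {}" and p: "p \<noteq> int (card V) - 2"
  shows "trivial_group (reduced_cohomology {J. J \<subset> V} p)"
proof -
  have fin: "finite V" using V(1) finite_subset by auto
  show ?thesis
  proof (cases "p < int (card V) - 2")
    case True
    obtain v where "v \<in> V" using V(2) by auto
    then have "trivial_group (reduced_cohomology (Pow V) p)"
      by (intro trivial_reduced_cohomology_cone[OF simplicial_complex_Pow[OF V(1)], of v]) auto
    moreover have "coboundary {J. J \<subset> V} q = coboundary (Pow V) q" if "q \<le> p" for q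
      using True that simplices_proper_subsets(1)[OF fin, of "q + 1"]
      by (simp add: fun_eq_iff coboundary_def)
    then have "reduced_cohomology {J. J \<subset> V} p = reduced_cohomology (Pow V) p"
      using True simplices_proper_subsets(1)[OF fin]
      by (simp add: reduced_cohomology_def cochain_group_def)
    ultimately show ?thesis by simp
  next
    case False
    note K = simplicial_complex_proper_subsets[OF V]
    have empty: "simplices {J. J \<subset> V} p = {}"
      using False p by (intro simplices_proper_subsets(2)[OF fin]) simp
    let ?b = "\<lambda>J\<in>simplices {J. J \<subset> V} (p - 1). 0"
    have zero: "f = coboundary {J. J \<subset> V} (p - 1) ?b" if "f \<in> cocycles {J. J \<subset> V} p" for f
      using that empty
      by (auto simp: cocycles_def kernel_def carrier_cochain_group coboundary_def restrict_def)
    have b: "?b \<in> carrier (cochain_group {J. J \<subset> V} (p - 1))"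
      by (simp add: carrier_cochain_group)
    show ?thesis
    proof (rule trivial_reduced_cohomologyI[OF K], rule subsetI)
      show "f \<in> coboundary {J. J \<subset> V} (p - 1) ` carrier (cochain_group {J. J \<subset> V} (p - 1))"
        if "f \<in> cocycles {J. J \<subset> V} p" for f
        using zero[OF that] b by (rule image_eqI[of f "coboundary {J. J \<subset> V} (p - 1)"])
    qed
  qed
qed

text \<open>In the top degree every cochain of the boundary is a cocycle. The isomorphism with \<open>\<int>\<close> is the
  signed sum over the facets, that is, the value at \<open>V\<close> of the coboundary taken in the full simplex.
  Its kernel consists of the cocycles of the full simplex; these are coboundaries because the
  simplex is a cone, and one degree lower the cochains of simplex and boundary agree.\<close>

lemma reduced_cohomology_proper_subsets_top:
  assumes V: "V \<subseteq> {1..m}" "V \<noteq> {}" and p: "p = int (card V) - 2"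
  shows "reduced_cohomology {J. J \<subset> V} p \<cong> integer_group"
proof -
  let ?D = "{J. J \<subset> V}"
  let ?C = "cochain_group ?D p"
  let ?\<phi> = "\<lambda>f. \<Sum>j\<in>V. incidence j V * f (V - {j})"
  have fin: "finite V" using V(1) finite_subset by auto
  obtain v where v: "v \<in> V" using V(2) by auto
  note Pow = simplicial_complex_Pow[OF V(1)]
  note simp_eq = simplices_proper_subsets(1)[OF fin]
  have VP: "simplices (Pow V) (p + 1) = {V}"
    using p card_subset_eq[OF fin] by (auto simp: simplices_def)
  have facet: "V - {j} \<in> simplices ?D p" if "j \<in> V" for j
    using simplices_face(1)[OF Pow, of V p j] VP that p simp_eq[of p] by simp
  have C: "?C = cochain_group (Pow V) p"
    using p simp_eq[of p] by (simp add: cochain_group_def)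
  interpret C: comm_group ?C by (rule comm_group_cochain_group)
  interpret \<phi>: group_hom ?C integer_group ?\<phi>
  proof (intro group_hom.intro group_hom_axioms.intro homI)
    fix f g
    show "?\<phi> (f \<otimes>\<^bsub>?C\<^esub> g) = ?\<phi> f \<otimes>\<^bsub>integer_group\<^esub> ?\<phi> g"
      using facet by (simp add: mult_cochain_group algebra_simps sum.distrib)
  qed (simp_all add: C.is_group)
  have "kernel ?C integer_group ?\<phi> = cocycles (Pow V) p"
    unfolding C cocycles_def kernel_def one_cochain_group coboundary_def VP
    by (auto simp: fun_eq_iff restrict_def)
  also have "\<dots> = coboundary (Pow V) (p - 1) ` carrier (cochain_group (Pow V) (p - 1))"
  proof
    show "cocycles (Pow V) p \<subseteq> coboundary (Pow V) (p - 1) ` carrier (cochain_group (Pow V) (p - 1))"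
    proof
      fix f assume "f \<in> cocycles (Pow V) p"
      then show "f \<in> coboundary (Pow V) (p - 1) ` carrier (cochain_group (Pow V) (p - 1))"
        using cone_cocycle_is_coboundary[OF Pow, of v f p] v by blast
    qed
  qed (use coboundary_cocycle[OF Pow] in blast)
  also have "\<dots> = coboundary ?D (p - 1) ` carrier (cochain_group ?D (p - 1))"
    using p simp_eq[of p] simp_eq[of "p - 1"] by (simp add: coboundary_def cochain_group_def)
  finally have ker: "kernel ?C integer_group ?\<phi> =
    coboundary ?D (p - 1) ` carrier (cochain_group ?D (p - 1))" .
  have "simplices ?D (p + 1) = {}"
    using p by (intro simplices_proper_subsets(2)[OF fin]) simp
  then have "kernel ?C (cochain_group ?D (p + 1)) (coboundary ?D p) = carrier ?C"
    by (auto simp: kernel_def one_cochain_group coboundary_def)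
  then have coh: "reduced_cohomology ?D p = ?C Mod kernel ?C integer_group ?\<phi>"
    unfolding reduced_cohomology_def cohomology_at_def ker by simp
  have "?\<phi> ` carrier ?C = carrier integer_group"
  proof -
    have "n \<in> ?\<phi> ` carrier ?C" for n
    proof -
      \<comment> \<open>Supported on the facet opposite to \<open>v\<close>; the sign cancels the one in \<open>?\<phi>\<close>.\<close>
      let ?f = "\<lambda>J\<in>simplices ?D p. if J = V - {v} then incidence v V * n else 0"
      have "?\<phi> ?f = (\<Sum>j\<in>V. if j = v then incidence v V * incidence v V * n else 0)"
        using facet v by (intro sum.cong) auto
      also have "\<dots> = n"
        using fin v by (simp add: incidence_square)
      finally show ?thesis
        by (intro image_eqI[of _ _ ?f]) (auto simp: carrier_cochain_group)
    qed
    then show ?thesis by auto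
  qed
  then show ?thesis
    unfolding coh by (rule \<phi>.FactGroup_iso)
qed


section \<open>Complexes of groups with a vanishing differential\<close>

lemma cohomology_at_trivial_neighbours:
  assumes A: "trivial_group A" and B: "group B" and C: "trivial_group C"
    and f: "f \<in> hom A B" and g: "g \<in> hom B C"
  shows "cohomology_at A f B g C \<cong> B"
proof -
  interpret F: group_hom A B f
    using A B f by (simp add: group_hom_def group_hom_axioms_def trivial_group_def)
  interpret G: group_hom B C g
    using B C g by (simp add: group_hom_def group_hom_axioms_def trivial_group_def)
  have "cohomology_at A f B g C = B Mod {\<one>\<^bsub>B\<^esub>}"
    using F.image_from_trivial_group[OF A] G.kernel_to_trivial_group[OF C]
    by (simp add: cohomology_at_def)
  then show ?thesis
    using group.trivial_factor_iso[OF B] by (auto simp: is_iso_def)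
qed

lemma trivial_HH:
  assumes K: "simplicial_complex_on m K" and H: "trivial_group (hochster m K k l)"
  shows "trivial_group (HH m K k l)"
proof -
  interpret HH: comm_group "HH m K k l" by (rule comm_group_HH[OF K])
  have "kernel (hochster m K k l) (hochster m K (k - 1) (l - 1)) (double_differential m K k l)
      \<subseteq> {\<one>\<^bsub>hochster m K k l\<^esub>}"
    using H by (auto simp: kernel_def trivial_group_def)
  then show ?thesis
    unfolding HH.trivial_group_alt by (auto simp: HH_def cohomology_at_def carrier_FactGroup)
qed

lemma HH_iso_hochster:
  assumes K: "simplicial_complex_on m K"
    and "trivial_group (hochster m K (k + 1) (l + 1))" "trivial_group (hochster m K (k - 1) (l - 1))"
  shows "HH m K k l \<cong> hochster m K k l"
  unfolding HH_def
  using double_differential_hom[OF K, of "k + 1" "l + 1"] double_differential_hom[OF K, of k l]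
    comm_group.axioms(2)[OF comm_group_hochster[OF K]]
  by (intro cohomology_at_trivial_neighbours assms) auto


section \<open>Moment-angle complexes of boundaries of simplices\<close>

lemma sum_group_singleton:
  assumes "group (G i)"
  shows "sum_group {i} G \<cong> G i"
proof -
  have carrier: "carrier (sum_group {i} G) = (\<Pi>\<^sub>E j\<in>{i}. carrier (G j))"
    by (subst carrier_sum_group) (use assms in auto)
  have "(\<lambda>x. x i) \<in> iso (sum_group {i} G) (G i)"
  proof (rule isoI)
    show "(\<lambda>x. x i) \<in> hom (sum_group {i} G) (G i)"
      by (rule homI) (simp_all add: carrier PiE_iff)
    show "bij_betw (\<lambda>x. x i) (carrier (sum_group {i} G)) (carrier (G i))"
      unfolding carrier
      by (rule bij_betw_byWitness[where f' = "\<lambda>y. \<lambda>j\<in>{i}. y"])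
        (auto simp: PiE_iff extensional_def fun_eq_iff split: if_splits)
  qed
  then show ?thesis by (auto simp: is_iso_def)
qed

lemma hochster_boundary_simplex_trivial:
  assumes m: "m \<ge> 1" and kl: "(k, l) \<noteq> (0, 0)" "(k, l) \<noteq> (1, int m)"
  shows "trivial_group (hochster m (boundary_simplex m) k l)"
proof -
  have "trivial_group (reduced_cohomology (full_subcomplex (boundary_simplex m) I) (l - k - 1))"
    if I: "I \<subseteq> {1..m}" "int (card I) = l" for I
  proof -
    consider "I = {}" | "I \<noteq> {}" "I \<noteq> {1..m}" | "I = {1..m}" by blast
    then show ?thesis
    proof cases
      case 1
      \<comment> \<open>The complex \<open>{{}}\<close> is the boundary of the simplex on any single vertex.\<close>
      have "full_subcomplex (boundary_simplex m) I = {J. J \<subset> {1}}"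
        using 1 m by (auto simp: full_subcomplex_def boundary_simplex_def)
      then show ?thesis
        using reduced_cohomology_proper_subsets_trivial[of "{1}" m "l - k - 1"] 1 I kl m by simp
    next
      case 2
      then obtain v where "v \<in> I" by blast
      moreover have "full_subcomplex (boundary_simplex m) I = Pow I"
        using 2 I by (auto simp: full_subcomplex_def boundary_simplex_def)
      ultimately show ?thesis
        using trivial_reduced_cohomology_cone[OF simplicial_complex_Pow[OF I(1)], of v] by simp
    next
      case 3
      have "full_subcomplex (boundary_simplex m) I = {J. J \<subset> {1..m}}"
        using 3 by (auto simp: full_subcomplex_def boundary_simplex_def)
      then show ?thesis
        using reduced_cohomology_proper_subsets_trivial[of "{1..m}" m "l - k - 1"] 3 I kl m by simp
    qed
  qed
  then have triv: "trivial_group (reduced_cohomology (full_subcomplex (boundary_simplex m) I) (l - k - 1))"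
    if "I \<in> index_sets m l" for I
    using that by (simp add: index_sets_def)
  have K: "simplicial_complex_on m (boundary_simplex m)"
    using simplicial_complex_boundary_simplex[OF m] .
  interpret H: comm_group "hochster m (boundary_simplex m) k l" by (rule comm_group_hochster[OF K])
  have one: "\<one>\<^bsub>hochster m (boundary_simplex m) k l\<^esub> = (\<lambda>I\<in>index_sets m l.
      \<one>\<^bsub>reduced_cohomology (full_subcomplex (boundary_simplex m) I) (l - k - 1)\<^esub>)"
    by (simp add: hochster_def)
  have "carrier (hochster m (boundary_simplex m) k l) = {\<one>\<^bsub>hochster m (boundary_simplex m) k l\<^esub>}"
    unfolding carrier_hochster[OF K] one PiE_eq_singleton
    using triv by (simp add: trivial_group_def)
  then show ?thesis by (simp add: trivial_group_def)
qed

text \<open>In both bidegrees a single index set \<open>I\<close> has the right size, and its full subcomplex is the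
  boundary of the simplex on a nonempty set \<open>V\<close>; for \<open>I = {}\<close> one takes a single vertex as \<open>V\<close>.\<close>

lemma hochster_boundary_simplex_integers:
  assumes m: "m \<ge> 1" and kl: "(k, l) = (0, 0) \<or> (k, l) = (1, int m)"
  shows "hochster m (boundary_simplex m) k l \<cong> integer_group"
proof -
  have K: "simplicial_complex_on m (boundary_simplex m)"
    using simplicial_complex_boundary_simplex[OF m] .
  obtain I V where I: "index_sets m l = {I}"
    and V: "full_subcomplex (boundary_simplex m) I = {J. J \<subset> V}" "V \<subseteq> {1..m}" "V \<noteq> {}"
      "l - k - 1 = int (card V) - 2"
    using kl
  proof
    assume kl: "(k, l) = (0, 0)"
    have "card I = 0 \<longleftrightarrow> I = {}" if "I \<subseteq> {1..m}" for I
      using finite_subset[OF that] by simp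
    then have "index_sets m l = {{}}" using kl by (auto simp: index_sets_def)
    moreover have "full_subcomplex (boundary_simplex m) {} = {J. J \<subset> {1}}"
      using m by (auto simp: full_subcomplex_def boundary_simplex_def)
    ultimately show ?thesis
      using m kl by (intro that[of "{}" "{1}"]) simp_all
  next
    assume kl: "(k, l) = (1, int m)"
    have "card I = m \<longleftrightarrow> I = {1..m}" if "I \<subseteq> {1..m}" for I
      using card_subset_eq[OF _ that] by auto
    then have "index_sets m l = {{1..m}}" using kl by (auto simp: index_sets_def)
    moreover have "full_subcomplex (boundary_simplex m) {1..m} = {J. J \<subset> {1..m}}"
      by (auto simp: full_subcomplex_def boundary_simplex_def)
    ultimately show ?thesis
      using m kl by (intro that[of "{1..m}" "{1..m}"]) simp_all
  qed
  have "hochster m (boundary_simplex m) k l \<cong> reduced_cohomology {J. J \<subset> V} (l - k - 1)"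
    unfolding hochster_def I V(1)[symmetric]
    by (intro sum_group_singleton comm_group.axioms(2)[OF comm_group_reduced_cohomology]
        simplicial_complex_full_subcomplex) (rule K)
  also have "\<dots> \<cong> integer_group"
    by (rule reduced_cohomology_proper_subsets_top[OF V(2,3,4)])
  finally show ?thesis .
qed

theorem proposition6p2:
  fixes m :: nat and K :: "nat set set" and k l :: int
  assumes "m \<ge> 2" and "K = boundary_simplex m"
  shows "if (- k, 2 * l) = (0, 0) \<or> (- k, 2 * l) = (- 1, 2 * int m)
         then HH m K k l \<cong> integer_group
         else trivial_group (HH m K k l)"
proof -
  have m: "m \<ge> 1" using assms(1) by simp
  have K: "simplicial_complex_on m (boundary_simplex m)"
    using simplicial_complex_boundary_simplex[OF m] .
  show ?thesis
  proof (cases "(k, l) = (0, 0) \<or> (k, l) = (1, int m)")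
    case True
    \<comment> \<open>Since \<open>m \<noteq> 1\<close>, no differential joins the places \<open>(1, m)\<close> and \<open>(0, 0)\<close>.\<close>
    have "HH m (boundary_simplex m) k l \<cong> hochster m (boundary_simplex m) k l"
      using True assms(1)
      by (intro HH_iso_hochster[OF K] hochster_boundary_simplex_trivial[OF m]) auto
    also have "\<dots> \<cong> integer_group"
      by (rule hochster_boundary_simplex_integers[OF m True])
    finally show ?thesis using True assms(2) by auto
  next
    case False
    then have "trivial_group (HH m (boundary_simplex m) k l)"
      by (intro trivial_HH[OF K] hochster_boundary_simplex_trivial[OF m]) auto
    then show ?thesis using False assms(2) by auto
  qed
qed

end
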